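(* There is a randomized algorithm that, given {\textsc{SET-EVAL}} access to a distribution $D$ on $[n]$ and $\epsilon>0$, estimates $\ell_2^2(D)=\sum_{j\in[n]}D(j)^2$ within a multiplicative $(1+\epsilon)$-factor with probability at least $3/4$, making at most $O(1/\epsilon^2)$ queries.
   Context: For a distribution $D$ on $[n]=\{1,\dots,n\}$ and $S\subseteq[n]$, $D(S)=\sum_{i\in S}D(i)$. A {\textsc{SET-EVAL}} oracle for $D$ takes as input any set $S\subseteq[n]$ and returns $D(S)$. $\ell_2(D)=(\sum_{j\in[n]}D(j)^2)^{1/2}$.
   Formalization: The query bound O(1/ε²) is stated as C·max(1, 1/ε²): for ε > 1 a constant number of queries is allowed, because with no queries at all one cannot tell a point mass from the uniform distribution on a large [n]. *)

theory Defs
  imports "HOL-Probability.Probability"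
begin

text \<open>
  Randomized adaptive query algorithms over \<open>[n] = {1..n}\<close> as well-founded trees. The algorithm
  learns about the unknown distribution only through the answers to its \<open>Query\<close> nodes; its
  internal randomness consists of independent fair coins (\<open>Flip\<close>), which are not counted as queries.
\<close>

datatype query_alg =
    Output real
  | Query "nat set" "real \<Rightarrow> query_alg"
  | Flip "bool \<Rightarrow> query_alg"

text \<open>Joint distribution of the output and of the list of sets queried.\<close>

primrec run :: "(nat set \<Rightarrow> real) \<Rightarrow> query_alg \<Rightarrow> (real \<times> nat set list) pmf" where
  "run orc (Output x) = return_pmf (x, [])"
| "run orc (Query S k) = map_pmf (\<lambda>(x, qs). (x, S # qs)) (run orc (k (orc S)))"
| "run orc (Flip k) = bind_pmf (bernoulli_pmf (1/2)) (\<lambda>b. run orc (k b))"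

definition distribution_on :: "nat \<Rightarrow> nat pmf \<Rightarrow> bool" where
  "distribution_on n D \<longleftrightarrow> set_pmf D \<subseteq> {1..n}"

text \<open>The value \<open>D(S)\<close>, meaningful for finite \<open>S\<close> only; legal queries are subsets of \<open>{1..n}\<close>.\<close>

definition set_eval :: "nat pmf \<Rightarrow> nat set \<Rightarrow> real" where
  "set_eval D S = (\<Sum>i\<in>S. pmf D i)"

definition l2_norm :: "nat \<Rightarrow> nat pmf \<Rightarrow> real" where
  "l2_norm n D = sqrt (\<Sum>j\<in>{1..n}. (pmf D j)\<^sup>2)"

definition within_factor :: "real \<Rightarrow> real \<Rightarrow> real \<Rightarrow> bool" where
  "within_factor c v x \<longleftrightarrow> v / c \<le> x \<and> x \<le> c * v"

end

theory Submission
  imports Defs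
begin

text \<open>
  The tug-of-war estimator of Alon, Matias and Szegedy. For a uniformly random subset \<open>S\<close> of
  \<open>{1..n}\<close>, the single query \<open>D(S)\<close> gives \<open>Z = 2 D(S) - 1 = \<Sum>i. \<sigma>\<^sub>i D(i)\<close> with independent uniform
  signs \<open>\<sigma>\<^sub>i\<close>. Then \<open>E Z\<^sup>2 = \<ell>\<^sub>2\<^sup>2(D)\<close> and \<open>E Z\<^sup>4 \<le> 3 \<ell>\<^sub>2\<^sup>4(D)\<close>, so the average of \<open>K\<close> independent
  copies of \<open>Z\<^sup>2\<close> has variance at most \<open>2 \<ell>\<^sub>2\<^sup>4(D) / K\<close>, and Chebyshev's inequality with
  \<open>K \<ge> 32 / \<epsilon>\<^sup>2\<close> bounds the failure probability by \<open>1/4\<close>.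
\<close>

section \<open>Sums of independent copies\<close>

text \<open>Law of total expectation. Finite supports turn every integral into a finite sum; this
  suffices, since only finitely many coins are flipped.\<close>

lemma expectation_bind_pmf_finite:
  fixes h :: "'b \<Rightarrow> real"
  assumes "finite (set_pmf p)" and "\<And>x. x \<in> set_pmf p \<Longrightarrow> finite (set_pmf (f x))"
  shows "measure_pmf.expectation (p \<bind> f) h
       = measure_pmf.expectation p (\<lambda>x. measure_pmf.expectation (f x) h)"
  using assms
  by (simp add: pmf_expectation_bind[of "set_pmf p"] integral_measure_pmf_real[of "set_pmf p"]
      mult.commute)

text \<open>Peeling off the first summand mirrors the round-by-round recursion of
  \<open>tug_of_war\<close>.\<close>

primrec iid_sum :: "real pmf \<Rightarrow> nat \<Rightarrow> real pmf" where
  "iid_sum p 0 = return_pmf 0"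
| "iid_sum p (Suc m) = p \<bind> (\<lambda>x. map_pmf ((+) x) (iid_sum p m))"

lemma finite_set_pmf_iid_sum [simp]:
  "finite (set_pmf p) \<Longrightarrow> finite (set_pmf (iid_sum p m))"
  by (induction m) auto

lemma expectation_iid_sum:
  assumes fin: "finite (set_pmf p)"
  shows "measure_pmf.expectation (iid_sum p m) (\<lambda>t. t) = m * measure_pmf.expectation p (\<lambda>x. x)"
proof (induction m)
  case (Suc m)
  note [simp] = fin integrable_measure_pmf_finite
  show ?case
    by (simp add: expectation_bind_pmf_finite Suc algebra_simps)
qed simp

lemma variance_iid_sum:
  assumes fin: "finite (set_pmf p)" and mean: "measure_pmf.expectation p (\<lambda>x. x) = \<mu>"
  shows "measure_pmf.expectation (iid_sum p m) (\<lambda>t. (t - m * \<mu>)\<^sup>2)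
       = m * measure_pmf.expectation p (\<lambda>x. (x - \<mu>)\<^sup>2)"
proof (induction m)
  case (Suc m)
  note [simp] = fin integrable_measure_pmf_finite
  let ?T = "iid_sum p m" and ?v = "measure_pmf.expectation p (\<lambda>x. (x - \<mu>)\<^sup>2)"
  have "measure_pmf.expectation ?T (\<lambda>t. (x + t - Suc m * \<mu>)\<^sup>2) = m * ?v + (x - \<mu>)\<^sup>2" for x
  proof -
    have "measure_pmf.expectation ?T (\<lambda>t. (x + t - Suc m * \<mu>)\<^sup>2)
        = measure_pmf.expectation ?T
            (\<lambda>t. (t - m * \<mu>)\<^sup>2 + (2 * (x - \<mu>) * (t - m * \<mu>) + (x - \<mu>)\<^sup>2))"
      by (rule Bochner_Integration.integral_cong) (auto simp: power2_eq_square algebra_simps)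
    \<comment> \<open>The cross term averages to zero because \<open>t\<close> has mean
      \<open>m * \<mu>\<close>; this is where independence of the summands enters.\<close>
    also have "\<dots> = m * ?v + (x - \<mu>)\<^sup>2"
      by (simp add: Suc expectation_iid_sum mean)
    finally show ?thesis .
  qed
  then show ?case
    by (simp add: expectation_bind_pmf_finite algebra_simps)
qed simp

text \<open>Chebyshev's inequality. The variance enters through an upper bound \<open>v\<close>,
  since only a bound on the fourth moment will be available.\<close>

lemma prob_iid_sum_deviation:
  assumes fin: "finite (set_pmf p)" and mean: "measure_pmf.expectation p (\<lambda>x. x) = \<mu>"
    and var: "measure_pmf.expectation p (\<lambda>x. (x - \<mu>)\<^sup>2) \<le> v" and "a > 0"
  shows "measure_pmf.prob (iid_sum p m) {t. a \<le> \<bar>t - m * \<mu>\<bar>} \<le> m * v / a\<^sup>2"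
proof -
  have "measure_pmf.prob (iid_sum p m) {t. a \<le> \<bar>t - m * \<mu>\<bar>}
      \<le> measure_pmf.expectation (iid_sum p m) (\<lambda>t. (t - m * \<mu>)\<^sup>2) / a\<^sup>2"
    using measure_pmf.Chebyshev_inequality[of "\<lambda>t. t" "iid_sum p m" a] fin \<open>a > 0\<close>
    by (simp add: integrable_measure_pmf_finite expectation_iid_sum mean)
  also have "\<dots> \<le> m * v / a\<^sup>2"
    unfolding variance_iid_sum[OF fin mean] using var
    by (intro divide_right_mono mult_left_mono) auto
  finally show ?thesis .
qed

section \<open>Moments of a random signed sum\<close>

text \<open>The uniform distribution on subsets of \<open>{1..m}\<close>, built from one fair coin
  per element so that \<open>Flip\<close> nodes can simulate it.\<close>

primrec random_subset :: "nat \<Rightarrow> nat set pmf" where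
  "random_subset 0 = return_pmf {}"
| "random_subset (Suc m) = bernoulli_pmf (1/2) \<bind>
     (\<lambda>b. map_pmf (\<lambda>S. if b then insert (Suc m) S else S) (random_subset m))"

lemma random_subset_subset: "S \<in> set_pmf (random_subset m) \<Longrightarrow> S \<subseteq> {1..m}"
proof (induction m arbitrary: S)
  case (Suc m)
  then obtain R where "R \<in> set_pmf (random_subset m)" "S \<subseteq> insert (Suc m) R"
    by (auto split: if_splits)
  with Suc.IH[of R] show ?case by force
qed simp

lemma finite_set_pmf_random_subset [simp]: "finite (set_pmf (random_subset m))"
  by (rule finite_subset[of _ "Pow {1..m}"]) (use random_subset_subset in auto)

text \<open>For \<open>S \<subseteq> {1..m}\<close> this is the sum of the \<open>a i\<close> with
  sign plus on \<open>S\<close> and minus off \<open>S\<close>, in a form computable from the single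
  value \<open>sum a S\<close>.\<close>

definition signed_sum :: "(nat \<Rightarrow> real) \<Rightarrow> nat \<Rightarrow> nat set \<Rightarrow> real" where
  "signed_sum a m S = 2 * sum a S - sum a {1..m}"

lemma signed_sum_Suc:
  assumes "S \<subseteq> {1..m}"
  shows "signed_sum a (Suc m) S = signed_sum a m S - a (Suc m)"
    and "signed_sum a (Suc m) (insert (Suc m) S) = signed_sum a m S + a (Suc m)"
proof -
  have "finite S" "Suc m \<notin> S"
    using assms finite_subset by auto
  then show "signed_sum a (Suc m) S = signed_sum a m S - a (Suc m)"
    "signed_sum a (Suc m) (insert (Suc m) S) = signed_sum a m S + a (Suc m)"
    by (simp_all add: signed_sum_def)
qed

text \<open>Condition on the last coin, which decides the sign of \<open>a (Suc m)\<close>. The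
  general \<open>h\<close> serves both the second and the fourth moment.\<close>

lemma expectation_signed_sum_Suc:
  fixes h :: "real \<Rightarrow> real"
  shows "measure_pmf.expectation (random_subset (Suc m)) (\<lambda>S. h (signed_sum a (Suc m) S))
       = measure_pmf.expectation (random_subset m)
           (\<lambda>S. (h (signed_sum a m S + a (Suc m)) + h (signed_sum a m S - a (Suc m))) / 2)"
proof -
  have "measure_pmf.expectation (random_subset (Suc m)) (\<lambda>S. h (signed_sum a (Suc m) S))
      = (measure_pmf.expectation (random_subset m)
           (\<lambda>S. h (signed_sum a (Suc m) (insert (Suc m) S)))
         + measure_pmf.expectation (random_subset m) (\<lambda>S. h (signed_sum a (Suc m) S))) / 2"
    by (simp add: expectation_bind_pmf_finite)
  \<comment> \<open>The integrands agree only for \<open>S \<subseteq> {1..m}\<close>, hence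
    equality almost everywhere.\<close>
  also have "\<dots> = (measure_pmf.expectation (random_subset m) (\<lambda>S. h (signed_sum a m S + a (Suc m)))
         + measure_pmf.expectation (random_subset m) (\<lambda>S. h (signed_sum a m S - a (Suc m)))) / 2"
    by (intro arg_cong2[where f = "(/)"] arg_cong2[where f = "(+)"] refl integral_cong_AE)
      (auto simp: AE_measure_pmf_iff signed_sum_Suc dest!: random_subset_subset)
  finally show ?thesis
    by (simp add: integrable_measure_pmf_finite)
qed

lemma expectation_signed_sum_power2:
  "measure_pmf.expectation (random_subset m) (\<lambda>S. (signed_sum a m S)\<^sup>2) = (\<Sum>i\<in>{1..m}. (a i)\<^sup>2)"
proof (induction m)
  case (Suc m)
  have parallelogram: "((x + y)\<^sup>2 + (x - y)\<^sup>2) / 2 = x\<^sup>2 + y\<^sup>2" for x y :: real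
    by (simp add: power2_eq_square algebra_simps)
  show ?case
    unfolding expectation_signed_sum_Suc[where h = "\<lambda>x. x\<^sup>2"] parallelogram
    using Suc by (simp add: integrable_measure_pmf_finite)
qed (simp add: signed_sum_def)

text \<open>Averaging over the new sign kills the odd powers. The constant 3 makes the surviving
  mixed term \<open>6 * ?a\<^sup>2 * ?F\<close> exactly the cross term of
  \<open>3 * (?F + ?a\<^sup>2)\<^sup>2\<close>, so the induction closes.\<close>

lemma expectation_signed_sum_power4_le:
  "measure_pmf.expectation (random_subset m) (\<lambda>S. (signed_sum a m S) ^ 4)
     \<le> 3 * (\<Sum>i\<in>{1..m}. (a i)\<^sup>2)\<^sup>2"
proof (induction m)
  case (Suc m)
  let ?F = "\<Sum>i\<in>{1..m}. (a i)\<^sup>2" and ?a = "a (Suc m)"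
  have fourth: "((x + y) ^ 4 + (x - y) ^ 4) / 2 = x ^ 4 + 6 * y\<^sup>2 * x\<^sup>2 + y ^ 4" for x y :: real
    by (simp add: power2_eq_square power4_eq_xxxx algebra_simps)
  have "measure_pmf.expectation (random_subset (Suc m)) (\<lambda>S. (signed_sum a (Suc m) S) ^ 4)
      = measure_pmf.expectation (random_subset m) (\<lambda>S. (signed_sum a m S) ^ 4) + 6 * ?a\<^sup>2 * ?F + ?a ^ 4"
    unfolding expectation_signed_sum_Suc[where h = "\<lambda>x. x ^ 4"] fourth
      expectation_signed_sum_power2[symmetric]
    by (simp add: integrable_measure_pmf_finite)
  also have "\<dots> \<le> 3 * ?F\<^sup>2 + 6 * ?a\<^sup>2 * ?F + 3 * ?a ^ 4"
    using Suc zero_le_even_power[of 4 ?a, OF even_numeral] by linarith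
  also have "\<dots> = 3 * (?F + ?a\<^sup>2)\<^sup>2"
    by (simp add: power2_eq_square power4_eq_xxxx algebra_simps)
  finally show ?case by simp
qed (simp add: signed_sum_def)

section \<open>The algorithm\<close>

text \<open>Continuation-passing style: \<open>query_alg\<close> has no sequencing operation, so
  \<open>k\<close> is what runs after the coins.\<close>

primrec flip_subset :: "nat \<Rightarrow> (nat set \<Rightarrow> query_alg) \<Rightarrow> query_alg" where
  "flip_subset 0 k = k {}"
| "flip_subset (Suc m) k =
     Flip (\<lambda>b. flip_subset m (\<lambda>S. k (if b then insert (Suc m) S else S)))"

lemma run_flip_subset: "run orc (flip_subset m k) = random_subset m \<bind> (\<lambda>S. run orc (k S))"
  by (induction m arbitrary: k) (simp_all add: bind_return_pmf bind_assoc_pmf bind_map_pmf)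

text \<open>The argument \<open>t\<close> accumulates the squares over the rounds, and
  \<open>g\<close> postprocesses the total, later by dividing by the number of rounds.\<close>

primrec tug_of_war :: "nat \<Rightarrow> (real \<Rightarrow> real) \<Rightarrow> nat \<Rightarrow> real \<Rightarrow> query_alg" where
  "tug_of_war n g 0 t = Output (g t)"
| "tug_of_war n g (Suc m) t =
     flip_subset n (\<lambda>S. Query S (\<lambda>v. tug_of_war n g m (t + (2 * v - 1)\<^sup>2)))"

lemma tug_of_war_queries:
  assumes "(x, qs) \<in> set_pmf (run orc (tug_of_war n g m t))"
  shows "(\<forall>S\<in>set qs. S \<subseteq> {1..n}) \<and> length qs = m"
  using assms
proof (induction m arbitrary: t x qs)
  case (Suc m)
  then obtain S qs' where "S \<in> set_pmf (random_subset n)" "qs = S # qs'"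
    "(x, qs') \<in> set_pmf (run orc (tug_of_war n g m (t + (2 * orc S - 1)\<^sup>2)))"
    by (auto simp: run_flip_subset)
  with Suc.IH random_subset_subset show ?case by fastforce
qed simp

text \<open>Every round flips fresh coins, and earlier answers influence only the accumulator, never
  the next query; hence the squares are independent.\<close>

lemma tug_of_war_output:
  "map_pmf fst (run orc (tug_of_war n g m t))
     = map_pmf (\<lambda>s. g (t + s))
         (iid_sum (map_pmf (\<lambda>S. (2 * orc S - 1)\<^sup>2) (random_subset n)) m)"
proof (induction m arbitrary: t)
  case (Suc m)
  have "map_pmf fst (run orc (tug_of_war n g (Suc m) t))
      = random_subset n \<bind> (\<lambda>S. map_pmf fst (run orc (tug_of_war n g m (t + (2 * orc S - 1)\<^sup>2))))"
    by (simp add: run_flip_subset map_bind_pmf pmf.map_comp o_def case_prod_beta)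
  then show ?case
    by (simp add: Suc map_bind_pmf bind_map_pmf pmf.map_comp o_def add.assoc)
qed simp

text \<open>With \<open>e = min 1 \<epsilon>\<close> and tolerated error \<open>e / 2 * F\<close>,
  Chebyshev bounds the failure probability for \<open>K\<close> rounds by
  \<open>8 / (K * e\<^sup>2)\<close>, which is at most 1/4 once \<open>K\<close> reaches
  \<open>32 / e\<^sup>2\<close>.\<close>

definition rounds :: "real \<Rightarrow> nat" where
  "rounds \<epsilon> = nat \<lceil>32 / (min 1 \<epsilon>)\<^sup>2\<rceil>"

lemma rounds_bounds:
  assumes "\<epsilon> > 0"
  shows "32 / (min 1 \<epsilon>)\<^sup>2 \<le> rounds \<epsilon>" "rounds \<epsilon> \<le> 33 * max 1 (1 / \<epsilon>\<^sup>2)" "rounds \<epsilon> > 0"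
proof -
  have eq: "1 / (min 1 \<epsilon>)\<^sup>2 = max 1 (1 / \<epsilon>\<^sup>2)"
    using assms by (auto simp: min_def max_def field_simps power_le_one_iff abs_square_le_1)
  have pos: "32 / (min 1 \<epsilon>)\<^sup>2 > 0"
    using assms by simp
  show lower: "32 / (min 1 \<epsilon>)\<^sup>2 \<le> rounds \<epsilon>"
    unfolding rounds_def by linarith
  show "rounds \<epsilon> > 0"
    using less_le_trans[OF pos lower] by simp
  \<comment> \<open>Rounding up costs at most 1, absorbed by
    \<open>max 1 (1 / \<epsilon>\<^sup>2)\<close>; this turns 32 into 33.\<close>
  have "rounds \<epsilon> \<le> 32 * (1 / (min 1 \<epsilon>)\<^sup>2) + 1"
    unfolding rounds_def using pos by simp
  then show "rounds \<epsilon> \<le> 33 * max 1 (1 / \<epsilon>\<^sup>2)"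
    unfolding eq by linarith
qed

text \<open>Halving the tolerance pays for the lower side, where division by
  \<open>1 + \<epsilon>\<close> needs \<open>(1 - e / 2) * (1 + e) \<ge> 1\<close>; this holds
  because the product is \<open>1 + (e - e * e) / 2\<close> and
  \<open>0 \<le> e \<le> 1\<close>.\<close>

lemma within_factorI:
  assumes "0 < \<epsilon>" "0 \<le> v" "\<bar>x - v\<bar> \<le> min 1 \<epsilon> / 2 * v"
  shows "within_factor (1 + \<epsilon>) v x"
proof -
  define e where "e = min 1 \<epsilon>"
  have e: "0 \<le> e" "e \<le> 1" "e \<le> \<epsilon>" "\<bar>x - v\<bar> \<le> e / 2 * v"
    using assms by (auto simp: e_def)
  have "e * e \<le> e"
    using e by (intro mult_left_le) auto
  then have "1 \<le> (1 - e / 2) * (1 + e)"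
    by (simp add: algebra_simps)
  also have "\<dots> \<le> (1 - e / 2) * (1 + \<epsilon>)"
    using e by (intro mult_left_mono) auto
  finally have "v * 1 \<le> v * ((1 - e / 2) * (1 + \<epsilon>))"
    using assms by (intro mult_left_mono)
  then have "v / (1 + \<epsilon>) \<le> (1 - e / 2) * v"
    using assms by (simp add: divide_le_eq mult_ac)
  moreover have "(1 + e / 2) * v \<le> (1 + \<epsilon>) * v"
    using assms e by (intro mult_right_mono) auto
  ultimately show ?thesis
    using abs_le_D1[OF e(4)] abs_le_D2[OF e(4)]
    unfolding within_factor_def by (simp add: algebra_simps)
qed

section \<open>The squared norm and the success probability of the estimator\<close>

lemma l2_norm_power2: "(l2_norm n D)\<^sup>2 = (\<Sum>j\<in>{1..n}. (pmf D j)\<^sup>2)"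
  by (simp add: l2_norm_def sum_nonneg)

text \<open>Makes the deviation threshold in Chebyshev's inequality positive.\<close>

lemma l2_norm_power2_pos:
  assumes "distribution_on n D"
  shows "(l2_norm n D)\<^sup>2 > 0"
proof -
  obtain j where "j \<in> set_pmf D"
    using set_pmf_not_empty[of D] by blast
  then have "j \<in> {1..n}" "(pmf D j)\<^sup>2 > 0"
    using assms by (auto simp: distribution_on_def set_pmf_iff)
  then show ?thesis
    unfolding l2_norm_power2 by (intro sum_pos2[of _ j]) auto
qed

definition tug_sample :: "nat \<Rightarrow> nat pmf \<Rightarrow> real pmf" where
  "tug_sample n D = map_pmf (\<lambda>S. (2 * set_eval D S - 1)\<^sup>2) (random_subset n)"

lemma tug_sample_moments:
  assumes "distribution_on n D"
  defines "F \<equiv> (l2_norm n D)\<^sup>2"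
  shows "measure_pmf.expectation (tug_sample n D) (\<lambda>x. x) = F"
    and "measure_pmf.expectation (tug_sample n D) (\<lambda>x. (x - F)\<^sup>2) \<le> 2 * F\<^sup>2"
proof -
  \<comment> \<open>Total mass 1 is what identifies \<open>2 * set_eval D S - 1\<close> with the
    signed sum.\<close>
  have "sum (pmf D) {1..n} = 1"
    using assms(1) by (intro sum_pmf_eq_1) (auto simp: distribution_on_def)
  then have sample: "tug_sample n D = map_pmf (\<lambda>S. (signed_sum (pmf D) n S)\<^sup>2) (random_subset n)"
    by (simp add: tug_sample_def set_eval_def signed_sum_def)
  let ?E = "measure_pmf.expectation (random_subset n)" and ?Z = "signed_sum (pmf D) n"
  have second: "?E (\<lambda>S. (?Z S)\<^sup>2) = F"
    by (simp only: expectation_signed_sum_power2 F_def l2_norm_power2)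
  then show "measure_pmf.expectation (tug_sample n D) (\<lambda>x. x) = F"
    by (simp add: sample)
  have "measure_pmf.expectation (tug_sample n D) (\<lambda>x. (x - F)\<^sup>2)
      = ?E (\<lambda>S. (?Z S) ^ 4 - 2 * F * (?Z S)\<^sup>2 + F\<^sup>2)"
    unfolding sample integral_map_pmf
    by (rule Bochner_Integration.integral_cong)
      (auto simp: power2_eq_square power4_eq_xxxx algebra_simps)
  also have "\<dots> = ?E (\<lambda>S. (?Z S) ^ 4) - F\<^sup>2"
    by (simp add: integrable_measure_pmf_finite second power2_eq_square[of F])
  \<comment> \<open>The fourth moment is at most \<open>3 * F\<^sup>2\<close>.\<close>
  also have "\<dots> \<le> 2 * F\<^sup>2"
    using expectation_signed_sum_power4_le[of n "pmf D"] by (simp add: F_def l2_norm_power2)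
  finally show "measure_pmf.expectation (tug_sample n D) (\<lambda>x. (x - F)\<^sup>2) \<le> 2 * F\<^sup>2" .
qed

lemma tug_of_war_success:
  assumes "\<epsilon> > 0" and D: "distribution_on n D"
  shows "measure_pmf.prob
      (run (set_eval D) (tug_of_war n (\<lambda>t. t / rounds \<epsilon>) (rounds \<epsilon>) 0))
      {(x, qs). within_factor (1 + \<epsilon>) ((l2_norm n D)\<^sup>2) x} \<ge> 3 / 4"
proof -
  define K where "K = rounds \<epsilon>"
  define F where "F = (l2_norm n D)\<^sup>2"
  define e where "e = min 1 \<epsilon>"
  \<comment> \<open>The tolerated error of the average, scaled by \<open>K\<close> because Chebyshev
    is applied to the unnormalised sum.\<close>
  define a where "a = K * (e / 2 * F)"
  let ?T = "iid_sum (tug_sample n D) K" and ?A = "run (set_eval D) (tug_of_war n (\<lambda>t. t / K) K 0)"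
  have "F > 0" "e > 0"
    using l2_norm_power2_pos[OF D] \<open>\<epsilon> > 0\<close> by (auto simp: F_def e_def)
  have K: "K > 0" "32 / e\<^sup>2 \<le> K"
    using rounds_bounds[OF \<open>\<epsilon> > 0\<close>] by (auto simp: K_def e_def)
  then have "a > 0"
    using \<open>F > 0\<close> \<open>e > 0\<close> by (simp add: a_def)
  have "measure_pmf.prob ?T {t. a \<le> \<bar>t - K * F\<bar>} \<le> K * (2 * F\<^sup>2) / a\<^sup>2"
    using tug_sample_moments[OF D] \<open>a > 0\<close> unfolding F_def
    by (intro prob_iid_sum_deviation) (auto simp: tug_sample_def)
  \<comment> \<open>The value \<open>8 / (K * e\<^sup>2)\<close>, written so that
    \<open>32 / e\<^sup>2 \<le> K\<close> applies directly.\<close>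
  also have "\<dots> = (32 / e\<^sup>2) / (4 * K)"
    using K \<open>F > 0\<close> \<open>e > 0\<close> by (simp add: a_def field_simps power2_eq_square)
  also have "\<dots> \<le> K / (4 * K)"
    using K by (intro divide_right_mono) auto
  also have "\<dots> = 1 / 4"
    using K by simp
  finally have fail: "measure_pmf.prob ?T {t. a \<le> \<bar>t - K * F\<bar>} \<le> 1 / 4" .
  have good: "within_factor (1 + \<epsilon>) F (t / K)" if "\<not> a \<le> \<bar>t - K * F\<bar>" for t
  proof (rule within_factorI)
    have "t / K - F = (t - K * F) / K"
      using K by (simp add: field_simps)
    then have "\<bar>t / K - F\<bar> = \<bar>t - K * F\<bar> / K"
      by simp
    also have "\<dots> \<le> a / K"
      using that by (intro divide_right_mono) auto
    finally show "\<bar>t / K - F\<bar> \<le> min 1 \<epsilon> / 2 * F"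
      using K by (simp add: a_def e_def)
  qed (use \<open>\<epsilon> > 0\<close> \<open>F > 0\<close> in auto)
  have "3 / 4 \<le> 1 - measure_pmf.prob ?T {t. a \<le> \<bar>t - K * F\<bar>}"
    using fail by simp
  also have "\<dots> = measure_pmf.prob ?T (UNIV - {t. a \<le> \<bar>t - K * F\<bar>})"
    using measure_pmf.prob_compl[of "{t. a \<le> \<bar>t - K * F\<bar>}" ?T] by simp
  also have "\<dots> \<le> measure_pmf.prob ?T {t. within_factor (1 + \<epsilon>) F (t / K)}"
    using good by (intro measure_pmf.finite_measure_mono) auto
  also have "\<dots> = measure_pmf.prob (map_pmf (\<lambda>t. t / K) ?T) {x. within_factor (1 + \<epsilon>) F x}"
    by (simp add: vimage_def)
  \<comment> \<open>Forgetting the query list, the output of the run is the rescaled sum of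
    independent samples.\<close>
  also have "map_pmf (\<lambda>t. t / K) ?T = map_pmf fst ?A"
    by (simp add: tug_of_war_output tug_sample_def)
  also have "measure_pmf.prob (map_pmf fst ?A) {x. within_factor (1 + \<epsilon>) F x}
      = measure_pmf.prob ?A {(x, qs). within_factor (1 + \<epsilon>) F x}"
    by (simp add: vimage_def case_prod_unfold)
  finally show ?thesis
    by (simp add: K_def F_def)
qed

(* For eps > 1 the bound O(1/eps^2) is read as O(1): a constant number of queries is always allowed. *)
theorem theorem4p3:
  "\<exists>(A :: nat \<Rightarrow> real \<Rightarrow> query_alg) (C :: real). C > 0 \<and>
     (\<forall>(n :: nat) (\<epsilon> :: real) (D :: nat pmf). \<epsilon> > 0 \<longrightarrow> distribution_on n D \<longrightarrow>
        (\<forall>(x, qs) \<in> set_pmf (run (set_eval D) (A n \<epsilon>)).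
            (\<forall>S \<in> set qs. S \<subseteq> {1..n}) \<and>
            real (length qs) \<le> C * max 1 (1 / \<epsilon>\<^sup>2)) \<and>
        measure_pmf.prob (run (set_eval D) (A n \<epsilon>))
            {(x, qs). within_factor (1 + \<epsilon>) ((l2_norm n D)\<^sup>2) x} \<ge> 3 / 4)"
\<comment> \<open>The accumulator starts at 0 and the final division forms the average; 33 is the
  constant of \<open>rounds_bounds\<close>. The query bound holds on every run, since each round
  makes exactly one query.\<close>
proof (intro exI[of _ "\<lambda>n \<epsilon>. tug_of_war n (\<lambda>t. t / rounds \<epsilon>) (rounds \<epsilon>) 0"] exI[of _ 33]
    conjI allI impI)
  fix n :: nat and \<epsilon> :: real and D :: "nat pmf"
  assume "\<epsilon> > 0" and D: "distribution_on n D"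
  let ?A = "run (set_eval D) (tug_of_war n (\<lambda>t. t / rounds \<epsilon>) (rounds \<epsilon>) 0)"
  show "\<forall>(x, qs) \<in> set_pmf ?A. (\<forall>S \<in> set qs. S \<subseteq> {1..n}) \<and>
      real (length qs) \<le> 33 * max 1 (1 / \<epsilon>\<^sup>2)"
    using rounds_bounds(2)[OF \<open>\<epsilon> > 0\<close>] by (fastforce dest: tug_of_war_queries)
  show "measure_pmf.prob ?A {(x, qs). within_factor (1 + \<epsilon>) ((l2_norm n D)\<^sup>2) x} \<ge> 3 / 4"
    using tug_of_war_success[OF \<open>\<epsilon> > 0\<close> D] .
qed simp

end
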